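(* Let $f:\mathbb{R}^n\to\mathbb{R}$ be a $\mathcal{C}^1$-smooth function with a locally Lipschitzian gradient, let $\bar x\in\mathbb{R}^n$, and let $\Delta>0$. Assume that $\bar x$ is a local minimizer of $f$, that $f$ satisfies the KL property at $\bar x$, and that the iterates $x^k$ generated by Algorithm DFB (described in the context) satisfy $\nabla f(x^k)\ne0$ for all $k\in\mathbb{N}$. Then there are constants $\xi,T,C>0$ such that for any initial point $x^1\in\mathbb{B}(\bar x,\xi)$, any initial sampling radius $\delta_1\in(0,\Delta]$, $\bar\tau\in(0,T]$, $C_1\ge C$, and the other parameters of Algorithm DFB, the sequence of iterates $\{x^k\}$ in this algorithm converges to some local minimizer $\tilde x$ of $f$ with $f(\tilde x)=f(\bar x)$. The following convergence rates are guaranteed if the sequence of stepsizes $\{\tau_k\}$ is bounded away from $0$, and if $f$ satisfies the KL property at $\bar x$ with $\psi(t)=Mt^q$, $M>0$, and $q\in(0,1)$: - If $q\in(0,1/2]$, the sequences $\{x^k\}$, $\{\nabla f(x^k)\}$, and $\{f(x^k)\}$ converge linearly as $k\to\infty$ to $\tilde x$, $0\in\mathbb{R}^n$, and $f(\bar x)$, respectively. - If $q\in(1/2,1)$, then $\|x^k-\tilde x\|=\mathcal{O}\big(k^{-\frac{1-q}{2q-1}}\big)$, $\|\nabla f(x^k)\|=\mathcal{O}\big(k^{-\frac{1-q}{2q-1}}\big)$, and $f(x^k)-f(\bar x)=\mathcal{O}\big(k^{-\frac{2-2q}{2q-1}}\big)$ as $k\to\infty$.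
   Context: $\|\cdot\|$ is the Euclidean norm on $\mathbb{R}^n$, $\mathbb{N}=\{1,2,\dots\}$, and $\mathbb{B}(x,\varepsilon)$ is the open ball of center $x$ and radius $\varepsilon$. A locally Lipschitzian gradient means that $\nabla f$ is Lipschitz continuous on every compact subset of $\mathbb{R}^n$. Local approximation: a mapping $\mathcal{G}:\mathbb{R}^n\times(0,\infty)\to\mathbb{R}^n$ is a local approximation of $\nabla f$ if for any bounded set $\Omega\subset\mathbb{R}^n$ and any $\Delta'>0$ there is $C'>0$ such that $\|\mathcal{G}(x,\delta)-\nabla f(x)\|\le C'\delta$ for all $(x,\delta)\in\Omega\times(0,\Delta']$. Algorithm DFB (Derivative-Free method with Backtracking stepsize). Step 0: Choose a local approximation $\mathcal{G}$ of $\nabla f$. Select an initial point $x^1\in\mathbb{R}^n$, an initial radius $\delta_1>0$, a constant $C_1>0$, factors $\theta\in(0,1)$, $\mu>2$, $\eta>1$, linesearch constants $\beta\in(0,1/2)$, $\gamma\in(0,1)$, $\bar\tau>0$, and an initial bound $t_1^{\min}\in(0,\bar\tau)$. Choose a sequence of manually controlled errors $\{\nu_k\}\subset(0,\infty)$ such that $\nu_k\downarrow0$ as $k\to\infty$. Set $k:=1$. Step 1: Select $g^k$ and the smallest nonnegative integer $i_k$ so that $g^k=\mathcal{G}(x^k,\min\{\theta^{i_k}\delta_k,\nu_k\})$ and $\|g^k\|>\mu C_k\theta^{i_k}\delta_k$ (such $g^k,i_k$ exist whenever $\nabla f(x^k)\neq0$). Then set $\delta_{k+1}:=\theta^{i_k}\delta_k$.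 Step 2: Set $t_k:=\bar\tau$. While $f(x^k-t_kg^k)>f(x^k)-\beta t_k\|g^k\|^2$ and $t_k\ge t_k^{\min}$, set $t_k:=\gamma t_k$. Step 3: If $t_k\ge t_k^{\min}$, then set $\tau_k:=t_k$, $C_{k+1}:=C_k$, and $t_{k+1}^{\min}:=t_k^{\min}$. Otherwise, set $\tau_k:=0$, $C_{k+1}:=\eta C_k$, and $t_{k+1}^{\min}:=\gamma t_k^{\min}$. Step 4: Set $x^{k+1}:=x^k-\tau_kg^k$. Increase $k$ by $1$ and go back to Step 1. KL property: a differentiable $f:\mathbb{R}^n\to\mathbb{R}$ satisfies the KL property at $\bar x$ if there exist a number $\eta'>0$, a neighborhood $U$ of $\bar x$, and a nondecreasing function $\psi:(0,\eta')\to(0,\infty)$ such that $1/\psi$ is integrable over $(0,\eta')$ and $\|\nabla f(x)\|\ge\psi\big(f(x)-f(\bar x)\big)$ for all $x\in U$ with $f(\bar x)<f(x)<f(\bar x)+\eta'$. "With $\psi(t)=Mt^q$" means that this property holds with that particular $\psi$ for some $\eta'$ and $U$. $\{\tau_k\}$ is bounded away from $0$ if there is $c_0>0$ with $\tau_k\ge c_0$ for all sufficiently large $k$. A sequence $\{z^k\}$ converges linearly to $z$ if there are $c>0$ and $\rho\in(0,1)$ with $\|z^k-z\|\le c\rho^k$ for all sufficiently large $k$.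
   Formalization: The constants ξ, T, C may depend on the local approximation G and on the KL data (η', ψ); the rates are for that same ψ(t)=Mt^q. Constants uniform over all G, or over all (M,q) for one f, do not exist in general. *)

theory Defs
  imports "HOL-Analysis.Analysis" "HOL-Library.Landau_Symbols" "HOL-Library.While_Combinator"
begin

definition gradient :: "('a::real_inner \<Rightarrow> real) \<Rightarrow> 'a \<Rightarrow> 'a" where
  "gradient f x = (THE D. GDERIV f x :> D)"

lemma GDERIV_gradient:
  fixes f :: "'a::euclidean_space \<Rightarrow> real"
  assumes "f differentiable (at x)"
  shows "GDERIV f x :> gradient f x"
proof -
  obtain f' where f': "(f has_derivative f') (at x)"
    using assms unfolding differentiable_def by blast
  then have lin: "linear f'"
    by (rule has_derivative_linear)
  have "f' = (\<lambda>h. h \<bullet> adjoint f' 1)"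
  proof
    show "f' h = h \<bullet> adjoint f' 1" for h
      using adjoint_works[OF lin, of h 1] by simp
  qed
  with f' have D: "GDERIV f x :> adjoint f' 1"
    unfolding gderiv_def by (rule back_subst)
  show ?thesis
    unfolding gradient_def
  proof (rule theI[where P = "\<lambda>D. GDERIV f x :> D", OF D])
    fix D' assume "GDERIV f x :> D'"
    then have "(\<lambda>h. h \<bullet> D') = (\<lambda>h. h \<bullet> adjoint f' 1)"
      using D unfolding gderiv_def by (rule has_derivative_unique)
    then have "\<forall>h. h \<bullet> D' = h \<bullet> adjoint f' 1"
      by (rule fun_eq_iff[THEN iffD1])
    then show "D' = adjoint f' 1"
      by (rule vector_eq_ldot[THEN iffD1])
  qed
qed

definition C1_smooth :: "('a::real_inner \<Rightarrow> real) \<Rightarrow> bool" where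
  "C1_smooth f \<longleftrightarrow> (\<forall>x. f differentiable (at x)) \<and> continuous_on UNIV (gradient f)"

definition locally_lipschitz_gradient :: "('a::real_inner \<Rightarrow> real) \<Rightarrow> bool" where
  "locally_lipschitz_gradient f \<longleftrightarrow> (\<forall>K. compact K \<longrightarrow> (\<exists>L. L-lipschitz_on K (gradient f)))"

definition local_minimizer :: "('a::topological_space \<Rightarrow> real) \<Rightarrow> 'a \<Rightarrow> bool" where
  "local_minimizer f x \<longleftrightarrow> (\<forall>\<^sub>F y in nhds x. f x \<le> f y)"

text \<open>Only the values at positive radii matter, so mappings defined for positive radii are
  represented by total functions.\<close>

definition local_approximation ::
    "('a::real_inner \<Rightarrow> real) \<Rightarrow> ('a \<Rightarrow> real \<Rightarrow> 'a) \<Rightarrow> bool" where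
  "local_approximation f G \<longleftrightarrow>
    (\<forall>\<Omega> \<Delta>'. bounded \<Omega> \<and> \<Delta>' > 0 \<longrightarrow>
      (\<exists>C'>0. \<forall>x\<in>\<Omega>. \<forall>\<delta>\<in>{0<..\<Delta>'}. norm (G x \<delta> - gradient f x) \<le> C' * \<delta>))"

text \<open>Only the restriction of \<open>\<psi>\<close> to the interval from \<open>0\<close> to \<open>\<eta>'\<close> matters. The pair
  \<open>\<eta>'\<close>, \<open>\<psi>\<close> is exposed because convergence rates depend on the form of \<open>\<psi>\<close>.\<close>

definition KL_property_with ::
    "('a::real_inner \<Rightarrow> real) \<Rightarrow> 'a \<Rightarrow> real \<Rightarrow> (real \<Rightarrow> real) \<Rightarrow> bool" where
  "KL_property_with f xbar \<eta>' \<psi> \<longleftrightarrow>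
    \<eta>' > 0 \<and>
    (\<forall>t\<in>{0<..<\<eta>'}. \<psi> t > 0) \<and>
    mono_on {0<..<\<eta>'} \<psi> \<and>
    (\<lambda>t. 1 / \<psi> t) absolutely_integrable_on {0<..<\<eta>'} \<and>
    (\<exists>U. open U \<and> xbar \<in> U \<and>
      (\<forall>x\<in>U. f xbar < f x \<and> f x < f xbar + \<eta>' \<longrightarrow> norm (gradient f x) \<ge> \<psi> (f x - f xbar)))"

definition bounded_away_from_zero :: "(nat \<Rightarrow> real) \<Rightarrow> bool" where
  "bounded_away_from_zero \<tau> \<longleftrightarrow> (\<exists>c>0. \<forall>\<^sub>F k in sequentially. \<tau> k \<ge> c)"

definition converges_linearly :: "(nat \<Rightarrow> 'a::real_normed_vector) \<Rightarrow> 'a \<Rightarrow> bool" where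
  "converges_linearly z l \<longleftrightarrow>
    (\<exists>c>0. \<exists>\<rho>\<in>{0<..<1}. \<forall>\<^sub>F k in sequentially. norm (z k - l) \<le> c * \<rho> ^ k)"

text \<open>All sequences are indexed from \<open>1\<close>; their values at index \<open>0\<close> are irrelevant.\<close>

record 'a dfb_params =
  dfb_x1 :: 'a
  dfb_delta1 :: real
  dfb_C1 :: real
  dfb_theta :: real
  dfb_mu :: real
  dfb_eta :: real
  dfb_beta :: real
  dfb_gamma :: real
  dfb_taubar :: real
  dfb_tmin1 :: real
  dfb_nu :: "nat \<Rightarrow> real"

definition dfb_admissible :: "'a dfb_params \<Rightarrow> bool" where
  "dfb_admissible P \<longleftrightarrow>
    dfb_delta1 P > 0 \<and> dfb_C1 P > 0 \<and>
    dfb_theta P \<in> {0<..<1} \<and> dfb_mu P > 2 \<and> dfb_eta P > 1 \<and>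
    dfb_beta P \<in> {0<..<1/2} \<and> dfb_gamma P \<in> {0<..<1} \<and>
    dfb_taubar P > 0 \<and> dfb_tmin1 P \<in> {0<..<dfb_taubar P} \<and>
    (\<forall>k\<ge>1. dfb_nu P k > 0) \<and> antimono_on {1..} (dfb_nu P) \<and> dfb_nu P \<longlonglongrightarrow> 0"

definition dfb_accept ::
    "('a::real_normed_vector \<Rightarrow> real \<Rightarrow> 'a) \<Rightarrow> 'a dfb_params \<Rightarrow> nat \<Rightarrow> 'a \<Rightarrow> real \<Rightarrow> real \<Rightarrow> nat \<Rightarrow> bool"
  where
  "dfb_accept G P k x \<delta> C i \<longleftrightarrow>
    norm (G x (min (dfb_theta P ^ i * \<delta>) (dfb_nu P k))) > dfb_mu P * C * (dfb_theta P ^ i * \<delta>)"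

definition dfb_backtrack ::
    "('a::real_normed_vector \<Rightarrow> real) \<Rightarrow> 'a dfb_params \<Rightarrow> 'a \<Rightarrow> 'a \<Rightarrow> real \<Rightarrow> real" where
  "dfb_backtrack f P x g tmin =
    while (\<lambda>t. f (x - t *\<^sub>R g) > f x - dfb_beta P * t * (norm g)\<^sup>2 \<and> t \<ge> tmin)
          (\<lambda>t. dfb_gamma P * t) (dfb_taubar P)"

definition DFB_run ::
    "('a::real_normed_vector \<Rightarrow> real) \<Rightarrow> ('a \<Rightarrow> real \<Rightarrow> 'a) \<Rightarrow> 'a dfb_params \<Rightarrow>
     (nat \<Rightarrow> 'a) \<Rightarrow> (nat \<Rightarrow> 'a) \<Rightarrow> (nat \<Rightarrow> nat) \<Rightarrow> (nat \<Rightarrow> real) \<Rightarrow> (nat \<Rightarrow> real) \<Rightarrow>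
     (nat \<Rightarrow> real) \<Rightarrow> (nat \<Rightarrow> real) \<Rightarrow> (nat \<Rightarrow> real) \<Rightarrow> bool" where
  "DFB_run f G P x g i \<delta> C tmin t \<tau> \<longleftrightarrow>
    x 1 = dfb_x1 P \<and> \<delta> 1 = dfb_delta1 P \<and> C 1 = dfb_C1 P \<and> tmin 1 = dfb_tmin1 P \<and>
    (\<forall>k\<ge>1.
      dfb_accept G P k (x k) (\<delta> k) (C k) (i k) \<and>
      (\<forall>j<i k. \<not> dfb_accept G P k (x k) (\<delta> k) (C k) j) \<and>
      g k = G (x k) (min (dfb_theta P ^ i k * \<delta> k) (dfb_nu P k)) \<and>
      \<delta> (Suc k) = dfb_theta P ^ i k * \<delta> k \<and>
      t k = dfb_backtrack f P (x k) (g k) (tmin k) \<and>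
      (if t k \<ge> tmin k
       then \<tau> k = t k \<and> C (Suc k) = C k \<and> tmin (Suc k) = tmin k
       else \<tau> k = 0 \<and> C (Suc k) = dfb_eta P * C k \<and> tmin (Suc k) = dfb_gamma P * tmin k) \<and>
      x (Suc k) = x k - \<tau> k *\<^sub>R g k)"

end

theory Submission
  imports Defs
begin

text \<open>
  Near \<open>xbar\<close> the acceptance test makes \<open>g k\<close> a uniformly good substitute for the gradient. As
  long as the iterate lies in a ball on which \<open>C\<^sub>0\<close> is the approximation constant, the error
  of \<open>g k\<close> is at most \<open>C\<^sub>0 * \<delta> (k + 1)\<close>, hence at most \<open>norm (g k) / \<mu>\<close>, and \<open>\<mu> > 2\<close>
  turns this into an error of at most half the norm of \<open>g k\<close>. A step \<open>\<tau>\<close> along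
  \<open>- g k\<close> therefore decreases \<open>f\<close> by at least \<open>\<tau> * (1/2 - L * \<tau>) * norm (g k)\<^sup>2\<close>, where
  \<open>L\<close> is a local Lipschitz constant of the gradient. With \<open>T = 1 / (4 * L)\<close> this is at least
  \<open>\<tau> * norm (g k)\<^sup>2 / 4\<close>. The linesearch itself promises only the factor \<open>\<beta>\<close>, which can be
  arbitrarily small; it is the bound \<open>T\<close> that makes the radius \<open>\<xi>\<close> independent of \<open>\<beta>\<close>.

  The decrease is thus at least \<open>norm (gradient f (x k)) * dist (x k) (x (k + 1)) / 6\<close>. Dividing by
  the gradient norm and applying the KL inequality bounds the length of each step by six times the
  drop of \<open>\<Phi> (f (x k) - f xbar)\<close>, where \<open>\<Phi>\<close> is the primitive of \<open>1 / \<psi>\<close>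
  (\<open>KL_length_bound\<close>). So the whole path is no longer than
  \<open>6 * \<Phi> (f (x 1) - f xbar)\<close>, which is small when \<open>x 1\<close> is close to \<open>xbar\<close>, and the
  iterates never leave the ball (\<open>trapped\<close>). The value \<open>f xbar\<close> is never attained on the way,
  since it is minimal in the ball and attaining it would make the gradient vanish.

  A failed linesearch multiplies the threshold by \<open>\<gamma>\<close>, but below a fixed positive size every
  trial step succeeds. So failures stop and the stepsizes stay above a positive constant
  (\<open>stepsize_eventually_bounded_below\<close>). The squared gradients are then dominated by value drops and
  tend to \<open>0\<close>, the KL inequality forces the values down to \<open>f xbar\<close>, and the
  length bound, applied to the tails, makes the iterates a Cauchy sequence with limit \<open>xt\<close>.

  For \<open>\<psi> s = M * s powr q\<close> the value gaps \<open>r k\<close> satisfy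
  \<open>r (k + 1) \<le> r k - b * r k powr (2 * q)\<close> with some \<open>b > 0\<close>. This is geometric decay for
  \<open>q \<le> 1/2\<close> and decay of order \<open>k powr (- 1 / (2 * q - 1))\<close> for \<open>q > 1/2\<close>. The distance
  to the limit is of order \<open>r k powr (1 - q)\<close> by the length bound, and the gradient is of order
  \<open>r k powr (1/2)\<close> because its square is dominated by the value drop.
\<close>

section \<open>Backtracking\<close>

lemma while_eq_funpow:
  assumes "\<And>m. m < j \<Longrightarrow> b ((c ^^ m) s)" and "\<not> b ((c ^^ j) s)"
  shows "while b c s = (c ^^ j) s"
  using assms
proof (induction j arbitrary: s)
  case 0
  then show ?case by (simp add: while_unfold)
next
  case (Suc j)
  have "b s" using Suc.prems(1)[of 0] by simp
  then have "while b c s = while b c (c s)" by (subst while_unfold) simp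
  also have "\<dots> = (c ^^ j) (c s)"
  proof (rule Suc.IH)
    show "b ((c ^^ m) (c s))" if "m < j" for m
      using Suc.prems(1)[of "Suc m"] that by (simp add: funpow_swap1)
    show "\<not> b ((c ^^ j) (c s))"
      using Suc.prems(2) by (simp add: funpow_swap1)
  qed
  finally show ?case by (simp add: funpow_swap1)
qed

lemma dfb_backtrack_cases:
  fixes f :: "'a::real_normed_vector \<Rightarrow> real"
  assumes \<gamma>: "dfb_gamma P \<in> {0<..<1}" and "tmin > 0"
  obtains j where "dfb_backtrack f P x g tmin = dfb_gamma P ^ j * dfb_taubar P"
    and "f (x - (dfb_gamma P ^ j * dfb_taubar P) *\<^sub>R g)
           \<le> f x - dfb_beta P * (dfb_gamma P ^ j * dfb_taubar P) * (norm g)\<^sup>2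
         \<or> dfb_gamma P ^ j * dfb_taubar P < tmin"
    and "\<And>m. m < j \<Longrightarrow>
      f (x - (dfb_gamma P ^ m * dfb_taubar P) *\<^sub>R g)
        > f x - dfb_beta P * (dfb_gamma P ^ m * dfb_taubar P) * (norm g)\<^sup>2"
proof -
  define b where "b = (\<lambda>t. f (x - t *\<^sub>R g) > f x - dfb_beta P * t * (norm g)\<^sup>2 \<and> t \<ge> tmin)"
  define c where "c = (\<lambda>t. dfb_gamma P * t)"
  have pow: "(c ^^ m) s = dfb_gamma P ^ m * s" for m s
    by (induction m) (auto simp: c_def)
  have "(\<lambda>m. dfb_gamma P ^ m * dfb_taubar P) \<longlonglongrightarrow> 0 * dfb_taubar P"
    using \<gamma> by (intro tendsto_mult LIMSEQ_power_zero) auto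
  then have "\<forall>\<^sub>F m in sequentially. dfb_gamma P ^ m * dfb_taubar P < tmin"
    using \<open>tmin > 0\<close> by (auto dest: order_tendstoD(2))
  then obtain m where "dfb_gamma P ^ m * dfb_taubar P < tmin"
    by (auto simp: eventually_sequentially)
  then have ex: "\<not> b ((c ^^ m) (dfb_taubar P))" by (simp add: b_def pow)
  define j where "j = (LEAST m. \<not> b ((c ^^ m) (dfb_taubar P)))"
  have j: "\<not> b ((c ^^ j) (dfb_taubar P))"
    unfolding j_def by (rule LeastI[of "\<lambda>m. \<not> b ((c ^^ m) (dfb_taubar P))", OF ex])
  have less: "b ((c ^^ m) (dfb_taubar P))" if "m < j" for m
    using not_less_Least[of m "\<lambda>m. \<not> b ((c ^^ m) (dfb_taubar P))"] that
    unfolding j_def by blast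
  have "dfb_backtrack f P x g tmin = (c ^^ j) (dfb_taubar P)"
    using while_eq_funpow[of j b c "dfb_taubar P", OF less j] unfolding dfb_backtrack_def b_def c_def by simp
  then show ?thesis
    using j less that[of j] unfolding b_def pow by force
qed

section \<open>Descent along inexact gradients\<close>

lemma gradient_zero_at_local_minimizer:
  fixes f :: "'a::euclidean_space \<Rightarrow> real"
  assumes "GDERIV f x :> gradient f x" and "open S" and "x \<in> S"
    and "\<And>y. y \<in> S \<Longrightarrow> f x \<le> f y"
  shows "gradient f x = 0"
proof -
  have "(\<lambda>h. h \<bullet> gradient f x) = (\<lambda>h. 0)"
    using differential_zero_maxmin[OF assms(3,2) assms(1)[unfolded gderiv_def]] assms(4) by blast
  then have "gradient f x \<bullet> gradient f x = 0" by metis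
  then show ?thesis by simp
qed

text \<open>The constant \<open>L\<close> in place of the sharp \<open>L / 2\<close> comes from the mean value theorem,
  whose intermediate gradient differs from the one at \<open>x\<close> by at most \<open>L * norm h\<close>; only the
  quadratic order of the remainder matters.\<close>

lemma gradient_mean_value_bound:
  fixes f :: "'a::euclidean_space \<Rightarrow> real"
  assumes D: "\<And>y. GDERIV f y :> gradient f y"
    and S: "convex S" "x \<in> S" "x + h \<in> S"
    and lip: "\<And>y z. y \<in> S \<Longrightarrow> z \<in> S \<Longrightarrow> norm (gradient f y - gradient f z) \<le> L * norm (y - z)"
    and L: "L \<ge> 0"
  shows "f (x + h) \<le> f x + h \<bullet> gradient f x + L * (norm h)\<^sup>2"
proof -
  have "((\<lambda>s. f (x + s *\<^sub>R h)) has_derivative 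
      (\<lambda>u. (u *\<^sub>R h) \<bullet> gradient f (x + s *\<^sub>R h))) (at s within {0..1})" for s
  proof -
    have "(f has_derivative (\<lambda>u. u \<bullet> gradient f (x + s *\<^sub>R h))) (at (x + s *\<^sub>R h))"
      using D unfolding gderiv_def .
    moreover have "((\<lambda>s. x + s *\<^sub>R h) has_derivative (\<lambda>u. u *\<^sub>R h)) (at s within {0..1})"
      by (auto intro!: derivative_eq_intros)
    ultimately show ?thesis by (rule has_derivative_compose[rotated])
  qed
  then obtain s where s: "s \<in> {0<..<1}"
    "f (x + 1 *\<^sub>R h) - f (x + 0 *\<^sub>R h) = ((1 - 0) *\<^sub>R h) \<bullet> gradient f (x + s *\<^sub>R h)"
    using mvt_simple[of 0 1 "\<lambda>s. f (x + s *\<^sub>R h)" "\<lambda>s u. (u *\<^sub>R h) \<bullet> gradient f (x + s *\<^sub>R h)"] by auto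
  have "(1 - s) *\<^sub>R x + s *\<^sub>R (x + h) \<in> S"
    using S s(1) by (intro convexD) auto
  then have "x + s *\<^sub>R h \<in> S" by (simp add: algebra_simps)
  then have "norm (gradient f (x + s *\<^sub>R h) - gradient f x) \<le> L * norm (x + s *\<^sub>R h - x)"
    using S lip by blast
  also have "\<dots> \<le> L * norm h"
    using s(1) L by (intro mult_left_mono) (auto intro: mult_left_le_one_le)
  finally have "norm h * norm (gradient f (x + s *\<^sub>R h) - gradient f x) \<le> norm h * (L * norm h)"
    by (intro mult_left_mono) auto
  moreover have "h \<bullet> (gradient f (x + s *\<^sub>R h) - gradient f x)
      \<le> norm h * norm (gradient f (x + s *\<^sub>R h) - gradient f x)"
    by (rule norm_cauchy_schwarz)
  ultimately have "h \<bullet> (gradient f (x + s *\<^sub>R h) - gradient f x) \<le> norm h * (L * norm h)"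
    by linarith
  then show ?thesis
    using s(2) by (simp add: inner_diff_right power2_eq_square algebra_simps)
qed

text \<open>An error of at most half the norm of \<open>g\<close> leaves
  \<open>g \<bullet> gradient f x \<ge> (norm g)\<^sup>2 / 2\<close>, so \<open>- g\<close> still is a descent direction.\<close>

lemma inexact_gradient_step_decrease:
  fixes f :: "'a::euclidean_space \<Rightarrow> real"
  assumes D: "\<And>y. GDERIV f y :> gradient f y"
    and S: "convex S" "x \<in> S" "x - t *\<^sub>R g \<in> S"
    and lip: "\<And>y z. y \<in> S \<Longrightarrow> z \<in> S \<Longrightarrow> norm (gradient f y - gradient f z) \<le> L * norm (y - z)"
    and L: "L \<ge> 0" and t: "t \<ge> 0" and g: "norm (g - gradient f x) \<le> norm g / 2"
  shows "f (x - t *\<^sub>R g) \<le> f x - t * (1/2 - L * t) * (norm g)\<^sup>2"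
proof -
  have "g \<bullet> (g - gradient f x) \<le> norm g * (norm g / 2)"
    using norm_cauchy_schwarz[of g "g - gradient f x"] mult_left_mono[OF g, of "norm g"] by simp
  then have "(norm g)\<^sup>2 / 2 \<le> g \<bullet> gradient f x"
    by (simp add: inner_diff_right power2_norm_eq_inner[symmetric] power2_eq_square)
  then have "t * ((norm g)\<^sup>2 / 2) \<le> t * (g \<bullet> gradient f x)"
    using t by (rule mult_left_mono)
  moreover have "f (x + - t *\<^sub>R g) \<le> f x + (- t *\<^sub>R g) \<bullet> gradient f x + L * (norm (- t *\<^sub>R g))\<^sup>2"
    using S by (intro gradient_mean_value_bound[OF D S(1) _ _ lip L]) auto
  ultimately show ?thesis
    by (simp add: power_mult_distrib algebra_simps power2_eq_square)
qed

section \<open>Desingularizing functions and path length\<close>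

text \<open>The usual desingularizing function is a primitive of \<open>1 / \<psi>\<close> vanishing at \<open>0\<close>. What the
  length argument uses is the slope inequality below, which is the concavity of that primitive. Stating
  it for an abstract \<open>\<Phi>\<close> serves both the integral of a general \<open>1 / \<psi>\<close> and the explicit power
  function from which the rates are read off.\<close>

definition desingularizing :: "real \<Rightarrow> (real \<Rightarrow> real) \<Rightarrow> (real \<Rightarrow> real) \<Rightarrow> bool" where
  "desingularizing e \<psi> \<Phi> \<longleftrightarrow>
    (\<forall>s\<in>{0<..<e}. 0 \<le> \<Phi> s) \<and>
    (\<forall>s1 s2. 0 < s1 \<and> s1 \<le> s2 \<and> s2 < e \<longrightarrow> (s2 - s1) / \<psi> s2 \<le> \<Phi> s2 - \<Phi> s1) \<and>
    (\<Phi> \<longlongrightarrow> 0) (at_right 0)"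

text \<open>By the slope inequality each step is paid for by a drop of \<open>\<Phi> (r k)\<close>, and these drops
  telescope. The range of indices is finite because the bound is also used in the induction
  that keeps the iterates in the ball, where the hypotheses are known only up to \<open>n\<close>.\<close>

lemma KL_length_bound:
  assumes \<Phi>: "desingularizing e \<psi> \<Phi>" and a: "a > 0" and "m \<le> n"
    and \<psi>: "\<And>s. s \<in> {0<..<e} \<Longrightarrow> \<psi> s > 0"
    and r: "\<And>k. m \<le> k \<Longrightarrow> k \<le> n \<Longrightarrow> r k \<in> {0<..<e}"
    and dec: "\<And>k. m \<le> k \<Longrightarrow> k < n \<Longrightarrow> a * \<psi> (r k) * dist (x k) (x (Suc k)) \<le> r k - r (Suc k)"
  shows "a * dist (x m) (x n) \<le> \<Phi> (r m)"
proof -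
  have "a * dist (x m) (x n) \<le> \<Phi> (r m) - \<Phi> (r n)"
    using \<open>m \<le> n\<close> r dec
  proof (induction n rule: dec_induct)
    case base
    then show ?case by simp
  next
    case (step k)
    have rk: "r k \<in> {0<..<e}" "r (Suc k) \<in> {0<..<e}" using step by auto
    have d: "a * \<psi> (r k) * dist (x k) (x (Suc k)) \<le> r k - r (Suc k)"
      using step by auto
    have "0 \<le> a * \<psi> (r k) * dist (x k) (x (Suc k))"
      using a \<psi>[OF rk(1)] by simp
    then have "(r k - r (Suc k)) / \<psi> (r k) \<le> \<Phi> (r k) - \<Phi> (r (Suc k))"
      using \<Phi> rk d unfolding desingularizing_def by auto
    moreover have "a * dist (x k) (x (Suc k)) \<le> (r k - r (Suc k)) / \<psi> (r k)"
      using d \<psi>[OF rk(1)] by (simp add: pos_le_divide_eq mult_ac)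
    moreover have "a * dist (x m) (x (Suc k)) \<le> a * dist (x m) (x k) + a * dist (x k) (x (Suc k))"
      using a mult_left_mono[OF dist_triangle[of "x m" "x (Suc k)" "x k"], of a]
      by (simp add: distrib_left)
    moreover have "a * dist (x m) (x k) \<le> \<Phi> (r m) - \<Phi> (r k)"
      using step by simp
    ultimately show ?case by linarith
  qed
  moreover have "0 \<le> \<Phi> (r n)" using \<Phi> r[of n] \<open>m \<le> n\<close> unfolding desingularizing_def by auto
  ultimately show ?thesis by linarith
qed

text \<open>Monotonicity of \<open>\<psi>\<close> bounds the integrand on \<open>{s1..s2}\<close> below by its value at \<open>s2\<close>,
  and integrability up to \<open>0\<close> gives the limit.\<close>

lemma desingularizing_integral:
  assumes "KL_property_with f xbar e \<psi>"
  shows "desingularizing e \<psi> (\<lambda>s. integral {0..s} (\<lambda>t. 1 / \<psi> t))"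
proof -
  define \<Phi> where "\<Phi> = (\<lambda>s. integral {0..s} (\<lambda>t. 1 / \<psi> t))"
  have e: "e > 0" and pos: "\<And>t. t \<in> {0<..<e} \<Longrightarrow> \<psi> t > 0" and mono: "mono_on {0<..<e} \<psi>"
    and ai: "(\<lambda>t. 1 / \<psi> t) absolutely_integrable_on {0<..<e}"
    using assms unfolding KL_property_with_def by auto
  have int: "(\<lambda>t. 1 / \<psi> t) integrable_on {0..e}"
    using set_lebesgue_integral_eq_integral(1)[OF ai]
    by (simp add: integrable_on_open_interval_real)
  have cont: "continuous_on {0..e} \<Phi>"
    unfolding \<Phi>_def using int by (rule indefinite_integral_continuous_1)
  have lim: "(\<Phi> \<longlongrightarrow> 0) (at_right 0)"
    using continuous_on_Icc_at_rightD[OF cont e] by (simp add: \<Phi>_def)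
  have slope: "(s2 - s1) / \<psi> s2 \<le> \<Phi> s2 - \<Phi> s1" if s: "0 < s1" "s1 \<le> s2" "s2 < e" for s1 s2
  proof -
    have int2: "(\<lambda>t. 1 / \<psi> t) integrable_on {0..s2}" "(\<lambda>t. 1 / \<psi> t) integrable_on {s1..s2}"
      using int s by (auto intro: integrable_on_subinterval)
    have "(s2 - s1) / \<psi> s2 = integral {s1..s2} (\<lambda>t. 1 / \<psi> s2)"
      using s by simp
    also have "\<dots> \<le> integral {s1..s2} (\<lambda>t. 1 / \<psi> t)"
    proof (rule integral_le)
      show "1 / \<psi> s2 \<le> 1 / \<psi> t" if "t \<in> {s1..s2}" for t
        using that s pos[of t] pos[of s2] monotone_onD[OF mono, of t s2]
        by (intro divide_left_mono mult_pos_pos) auto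
    qed (use int2 in auto)
    also have "\<dots> = \<Phi> s2 - \<Phi> s1"
      using Henstock_Kurzweil_Integration.integral_combine[of 0 s1 s2 "\<lambda>t. 1 / \<psi> t"] int2 s
      by (simp add: \<Phi>_def)
    finally show ?thesis .
  qed
  \<comment> \<open>Nonnegativity follows from monotonicity and the limit at \<open>0\<close>; the integrand itself may have any
    sign at the endpoint \<open>0\<close>.\<close>
  have "0 \<le> \<Phi> s" if s: "s \<in> {0<..<e}" for s
  proof (rule tendsto_upperbound[OF lim])
    show "\<forall>\<^sub>F u in at_right 0. \<Phi> u \<le> \<Phi> s"
      unfolding eventually_at_right_field
    proof (intro exI[of _ s] conjI allI impI)
      fix u :: real assume u: "0 < u" "u < s"
      have "0 \<le> (s - u) / \<psi> s" using u s pos[of s] by auto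
      then show "\<Phi> u \<le> \<Phi> s" using slope[of u s] u s by auto
    qed (use s in auto)
  qed auto
  with slope lim show ?thesis unfolding desingularizing_def \<Phi>_def by auto
qed

text \<open>This is the tangent inequality for the primitive \<open>s powr (1 - q) / (1 - q)\<close> of
  \<open>s powr (- q)\<close>, which is concave because that derivative is decreasing. The case \<open>q < 1\<close> yields a
  desingularizing function, the case \<open>q > 1\<close> the sublinear decay of recursive sequences.\<close>

lemma powr_slope:
  fixes s1 s2 q :: real
  assumes s: "0 < s1" "s1 \<le> s2" and q: "q > 0" "q \<noteq> 1"
  shows "(s2 - s1) * s2 powr (- q) \<le> (s2 powr (1 - q) - s1 powr (1 - q)) / (1 - q)"
proof (cases "s1 = s2")
  case False
  define F where "F = (\<lambda>s::real. s powr (1 - q) / (1 - q))"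
  have "DERIV F s :> s powr (- q)" if "s1 \<le> s" for s
    unfolding F_def using that s q by (auto intro!: derivative_eq_intros)
  then obtain z where z: "s1 < z" "z < s2" "F s2 - F s1 = (s2 - s1) * z powr (- q)"
    using MVT2[of s1 s2 F "\<lambda>s. s powr (- q)"] False s by auto
  have "s2 powr (- q) \<le> z powr (- q)"
    using z s q by (intro powr_mono2') auto
  then have "(s2 - s1) * s2 powr (- q) \<le> F s2 - F s1"
    using s by (auto simp: z(3) intro: mult_left_mono)
  then show ?thesis by (simp add: F_def diff_divide_distrib)
qed simp

lemma desingularizing_powr:
  assumes M: "M > 0" and q: "q \<in> {0<..<1}" and \<psi>: "\<And>s. s \<in> {0<..<e} \<Longrightarrow> \<psi> s = M * s powr q"
  shows "desingularizing e \<psi> (\<lambda>s. s powr (1 - q) / (M * (1 - q)))"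
  unfolding desingularizing_def
proof (intro conjI allI impI ballI)
  show "0 \<le> s powr (1 - q) / (M * (1 - q))" for s using M q by auto
next
  fix s1 s2 :: real assume s: "0 < s1 \<and> s1 \<le> s2 \<and> s2 < e"
  have "(s2 - s1) / \<psi> s2 = (s2 - s1) * s2 powr (- q) / M"
    using s M \<psi>[of s2] by (simp add: powr_minus field_simps)
  also have "\<dots> \<le> ((s2 powr (1 - q) - s1 powr (1 - q)) / (1 - q)) / M"
    using powr_slope[of s1 s2 q] s q M by (intro divide_right_mono) auto
  finally show "(s2 - s1) / \<psi> s2 \<le> s2 powr (1 - q) / (M * (1 - q)) - s1 powr (1 - q) / (M * (1 - q))"
    by (simp add: diff_divide_distrib mult.commute)
next
  have "((\<lambda>s::real. s powr (1 - q)) \<longlongrightarrow> 0) (at_right 0)"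
    using q by (auto intro!: tendsto_eq_intros simp: eventually_at_filter)
  then show "((\<lambda>s. s powr (1 - q) / (M * (1 - q))) \<longlongrightarrow> 0) (at_right 0)"
    by (rule tendsto_divide_zero)
qed

section \<open>Decay of recursive sequences\<close>

lemma geometric_decay:
  fixes r :: "nat \<Rightarrow> real"
  assumes b: "b \<in> {0<..<1}" and nonneg: "\<And>k. k \<ge> N \<Longrightarrow> r k \<ge> 0"
    and rec: "\<And>k. k \<ge> N \<Longrightarrow> r (Suc k) \<le> (1 - b) * r k"
  shows "\<exists>c>0. \<exists>\<rho>\<in>{0<..<1}. \<forall>k\<ge>N. r k \<le> c * \<rho> ^ k"
proof (intro exI[of _ "(r N + 1) / (1 - b) ^ N"] conjI bexI[of _ "1 - b"] allI impI)
  show "(r N + 1) / (1 - b) ^ N > 0" using b nonneg[of N] by auto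
  fix k assume "k \<ge> N"
  then show "r k \<le> (r N + 1) / (1 - b) ^ N * (1 - b) ^ k"
  proof (induction k rule: dec_induct)
    case base
    then show ?case using b by simp
  next
    case (step k)
    have "(1 - b) * r k \<le> (1 - b) * ((r N + 1) / (1 - b) ^ N * (1 - b) ^ k)"
      using step.IH b by (intro mult_left_mono) auto
    with rec[of k] step show ?case by (simp add: mult_ac)
  qed
qed (use b in auto)

lemma converges_linearly_of_power_bound:
  fixes z :: "nat \<Rightarrow> 'a::real_normed_vector"
  assumes bound: "\<And>k. k \<ge> N \<Longrightarrow> norm (z k - l) \<le> K * r k powr p"
    and r: "\<And>k. k \<ge> N \<Longrightarrow> 0 \<le> r k" "\<And>k. k \<ge> N \<Longrightarrow> r k \<le> c * \<rho> ^ k"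
    and c: "c > 0" and \<rho>: "\<rho> \<in> {0<..<1}" and p: "p > 0" and K: "K > 0"
  shows "converges_linearly z l"
  unfolding converges_linearly_def
proof (intro exI[of _ "K * c powr p"] conjI bexI[of _ "\<rho> powr p"])
  show "K * c powr p > 0" using c K by simp
  show "\<rho> powr p \<in> {0<..<1}" using \<rho> p powr_less_mono2[of p \<rho> 1] by simp
  show "\<forall>\<^sub>F k in sequentially. norm (z k - l) \<le> K * c powr p * (\<rho> powr p) ^ k"
    unfolding eventually_sequentially
  proof (intro exI[of _ N] allI impI)
    fix k assume k: "k \<ge> N"
    have "r k powr p \<le> (c * \<rho> ^ k) powr p"
      using r k p by (intro powr_mono2) auto
    also have "\<dots> = c powr p * (\<rho> powr p) ^ k"
      using c \<rho> by (simp add: powr_mult powr_realpow[symmetric] powr_powr mult.commute)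
    finally show "norm (z k - l) \<le> K * c powr p * (\<rho> powr p) ^ k"
      using order_trans[OF bound[OF k] mult_left_mono] K by (simp add: mult.assoc)
  qed
qed

text \<open>The recursion is a discrete form of \<open>r' = - b * r powr p\<close>, under which
  \<open>r powr (1 - p)\<close> grows at the constant rate \<open>b * (p - 1)\<close>. The tangent inequality shows that
  the discrete sequence grows at least as fast.\<close>

lemma sublinear_decay:
  fixes r :: "nat \<Rightarrow> real"
  assumes b: "b > 0" and p: "p > 1" and pos: "\<And>k. k \<ge> N \<Longrightarrow> r k > 0"
    and rec: "\<And>k. k \<ge> N \<Longrightarrow> r (Suc k) \<le> r k - b * r k powr p"
  shows "\<exists>A>0. \<exists>N'\<ge>N. \<forall>k\<ge>N'. r k \<le> A * real k powr (- (1 / (p - 1)))"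
proof -
  define d where "d = b * (p - 1)"
  have d: "d > 0" using b p by (simp add: d_def)
  have grow: "d * (real k - real N) \<le> r k powr (1 - p)" if "k \<ge> N" for k
    using that
  proof (induction k rule: dec_induct)
    case base
    then show ?case by simp
  next
    case (step k)
    have rk: "r k > 0" "r (Suc k) > 0" using pos step by auto
    have brk: "b * r k powr p \<le> r k - r (Suc k)" using rec step by (simp add: algebra_simps)
    moreover have "0 < b * r k powr p" using b rk by simp
    ultimately have le: "r (Suc k) \<le> r k" by linarith
    have "b = b * r k powr p * r k powr (- p)"
      using rk by (simp add: powr_minus field_simps)
    also have "\<dots> \<le> (r k - r (Suc k)) * r k powr (- p)"
      using brk by (intro mult_right_mono) auto
    also have "\<dots> \<le> (r k powr (1 - p) - r (Suc k) powr (1 - p)) / (1 - p)"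
      using powr_slope[of "r (Suc k)" "r k" p] rk le p by auto
    finally have "d \<le> r (Suc k) powr (1 - p) - r k powr (1 - p)"
      using p by (simp add: d_def field_simps)
    with step.IH show ?case by (simp add: algebra_simps)
  qed
  \<comment> \<open>From index \<open>2 * N + 1\<close> on, \<open>k - N\<close> is at least \<open>k / 2\<close>, which accounts for \<open>d / 2\<close>.\<close>
  have "r k \<le> (d / 2) powr (- (1 / (p - 1))) * real k powr (- (1 / (p - 1)))" if k: "k \<ge> 2 * N + 1" for k
  proof -
    have rk: "r k > 0" using pos k by simp
    have "d / 2 * real k \<le> d * (real k - real N)"
      using k d by (simp add: field_simps)
    also have "\<dots> \<le> r k powr (1 - p)" using grow k by simp
    finally have "(r k powr (1 - p)) powr (- (1 / (p - 1))) \<le> (d / 2 * real k) powr (- (1 / (p - 1)))"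
      using k d p by (intro powr_mono2') auto
    moreover have "(r k powr (1 - p)) powr (- (1 / (p - 1))) = r k"
    proof -
      have "(1 - p) * (- (1 / (p - 1))) = 1" using p by (simp add: field_simps)
      then show ?thesis using rk by (simp only: powr_powr) simp
    qed
    ultimately show ?thesis using d by (simp only: powr_mult)
  qed
  then show ?thesis
    using d by (intro exI[of _ "(d / 2) powr (- (1 / (p - 1)))"] conjI exI[of _ "2 * N + 1"]) auto
qed

lemma bigo_of_power_bound:
  fixes z :: "nat \<Rightarrow> real"
  assumes bound: "\<And>k. k \<ge> N \<Longrightarrow> \<bar>z k\<bar> \<le> K * r k powr s"
    and r: "\<And>k. k \<ge> N \<Longrightarrow> 0 \<le> r k" "\<And>k. k \<ge> N \<Longrightarrow> r k \<le> A * real k powr (- a)"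
    and A: "A > 0" and s: "s > 0" and K: "K > 0" and b: "b \<le> a * s"
  shows "z \<in> O(\<lambda>k. real k powr (- b))"
proof (rule bigoI[of _ "K * A powr s"])
  show "\<forall>\<^sub>F k in sequentially. norm (z k) \<le> K * A powr s * norm (real k powr (- b))"
    unfolding eventually_sequentially
  proof (intro exI[of _ "max N 1"] allI impI)
    fix k assume k: "k \<ge> max N 1"
    have "r k powr s \<le> (A * real k powr (- a)) powr s"
      using r k s by (intro powr_mono2) auto
    also have "\<dots> = A powr s * real k powr (- (a * s))"
      using A by (simp add: powr_mult powr_powr)
    also have "\<dots> \<le> A powr s * real k powr (- b)"
      using k b by (intro mult_left_mono powr_mono) auto
    finally show "norm (z k) \<le> K * A powr s * norm (real k powr (- b))"
      using order_trans[OF bound[of k] mult_left_mono] k K by (simp add: mult.assoc)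
  qed
qed

section \<open>Geometry near the minimizer\<close>

text \<open>Iterates are kept in the ball of radius \<open>R\<close>; the assumptions hold on the doubled ball so that
  a trial step from such an iterate, of length at most \<open>R\<close>, still ends where they apply.\<close>

locale KL_minimizer =
  fixes f :: "'a::euclidean_space \<Rightarrow> real" and xbar :: 'a and R L e :: real and \<psi> :: "real \<Rightarrow> real"
  assumes gderiv: "\<And>y. GDERIV f y :> gradient f y"
    and R_pos: "R > 0" and L_pos: "L > 0"
    and lipschitz: "\<And>y z. y \<in> ball xbar (2 * R) \<Longrightarrow> z \<in> ball xbar (2 * R) \<Longrightarrow>
      norm (gradient f y - gradient f z) \<le> L * norm (y - z)"
    and minimal: "\<And>y. y \<in> ball xbar (2 * R) \<Longrightarrow> f xbar \<le> f y"
    and \<psi>_pos: "\<And>s. s \<in> {0<..<e} \<Longrightarrow> \<psi> s > 0"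
    and \<psi>_mono: "mono_on {0<..<e} \<psi>"
    and KL: "\<And>y. y \<in> ball xbar (2 * R) \<Longrightarrow> f y - f xbar \<in> {0<..<e} \<Longrightarrow>
      \<psi> (f y - f xbar) \<le> norm (gradient f y)"
begin

lemma in_ballI: "y \<in> ball xbar R \<Longrightarrow> y \<in> ball xbar (2 * R)"
  using R_pos by auto

lemma gradient_zero_of_min_value:
  assumes "y \<in> ball xbar (2 * R)" and "f y = f xbar"
  shows "gradient f y = 0"
  using gradient_zero_at_local_minimizer[OF gderiv open_ball assms(1)] assms(2) minimal by simp

lemma local_minimizer_of_min_value:
  assumes "y \<in> ball xbar (2 * R)" and "f y = f xbar"
  shows "local_minimizer f y"
  unfolding local_minimizer_def eventually_nhds
  using assms minimal by (intro exI[of _ "ball xbar (2 * R)"]) auto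

lemma continuous_f: "continuous_on UNIV f"
  using gderiv unfolding gderiv_def
  by (auto intro!: has_derivative_continuous continuous_at_imp_continuous_on)

lemma gradient_bound:
  assumes "y \<in> ball xbar R"
  shows "norm (gradient f y) \<le> L * R"
proof -
  have "gradient f xbar = 0"
    using gradient_zero_of_min_value[of xbar] R_pos by simp
  then have "norm (gradient f y) \<le> L * norm (y - xbar)"
    using lipschitz[of y xbar] in_ballI[OF assms] R_pos by simp
  also have "\<dots> \<le> L * R"
    using assms L_pos by (intro mult_left_mono) (auto simp: dist_norm norm_minus_commute)
  finally show ?thesis .
qed

end

section \<open>A run started near the minimizer\<close>

text \<open>The smallness requirements on \<open>\<xi>\<close>, \<open>T\<close> and \<open>C\<^sub>0\<close>, in the form in which the analysis of
  a run uses them. The initial constant \<open>dfb_C1 P\<close> itself serves as approximation constant for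
  radii up to \<open>dfb_delta1 P\<close>, since the constants \<open>C k\<close> never fall below it and the radii
  \<open>\<delta> k\<close> never exceed \<open>dfb_delta1 P\<close>.\<close>

locale DFB_near_minimizer = KL_minimizer f xbar R L e \<psi>
  for f :: "'a::euclidean_space \<Rightarrow> real" and xbar R L e \<psi> +
  fixes G :: "'a \<Rightarrow> real \<Rightarrow> 'a" and P :: "'a dfb_params" and x g :: "nat \<Rightarrow> 'a"
    and i :: "nat \<Rightarrow> nat" and \<delta> C tmin t \<tau> :: "nat \<Rightarrow> real" and \<Phi> :: "real \<Rightarrow> real"
  assumes adm: "dfb_admissible P" and run: "DFB_run f G P x g i \<delta> C tmin t \<tau>"
    and noncritical: "\<And>k. k \<ge> 1 \<Longrightarrow> gradient f (x k) \<noteq> 0"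
    and taubar_small: "dfb_taubar P \<le> 1 / (4 * L)"
    and approx: "\<And>y d. y \<in> ball xbar R \<Longrightarrow> 0 < d \<Longrightarrow> d \<le> dfb_delta1 P \<Longrightarrow>
      norm (G y d - gradient f y) \<le> dfb_C1 P * d"
    and desing: "desingularizing e \<psi> \<Phi>"
    and start_ball: "x 1 \<in> ball xbar R"
    and start_value: "f (x 1) - f xbar < e"
    and start_length: "dist xbar (x 1) + 6 * \<Phi> (f (x 1) - f xbar) < R"
begin

abbreviation r :: "nat \<Rightarrow> real" where "r k \<equiv> f (x k) - f xbar"
abbreviation \<beta> where "\<beta> \<equiv> dfb_beta P"
abbreviation \<gamma> where "\<gamma> \<equiv> dfb_gamma P"

lemma params: "0 < \<beta>" "\<beta> < 1/2" "0 < \<gamma>" "\<gamma> < 1" "dfb_taubar P > 0" "dfb_mu P > 2" "dfb_eta P > 1"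
  "0 < dfb_theta P" "dfb_theta P < 1" "\<And>k. k \<ge> 1 \<Longrightarrow> dfb_nu P k > 0" "0 < dfb_C1 P" "0 < dfb_delta1 P"
  using adm unfolding dfb_admissible_def by auto

lemma run_step:
  assumes "k \<ge> 1"
  shows "dfb_accept G P k (x k) (\<delta> k) (C k) (i k)"
    "g k = G (x k) (min (dfb_theta P ^ i k * \<delta> k) (dfb_nu P k))"
    "\<delta> (Suc k) = dfb_theta P ^ i k * \<delta> k"
    "t k = dfb_backtrack f P (x k) (g k) (tmin k)"
    "t k \<ge> tmin k \<Longrightarrow> \<tau> k = t k \<and> C (Suc k) = C k \<and> tmin (Suc k) = tmin k"
    "\<not> t k \<ge> tmin k \<Longrightarrow> \<tau> k = 0 \<and> C (Suc k) = dfb_eta P * C k \<and> tmin (Suc k) = \<gamma> * tmin k"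
    "x (Suc k) = x k - \<tau> k *\<^sub>R g k"
  using run assms unfolding DFB_run_def by (auto split: if_splits)

lemma state_bounds:
  assumes "k \<ge> 1"
  shows "0 < \<delta> k \<and> \<delta> k \<le> dfb_delta1 P \<and> dfb_C1 P \<le> C k \<and> 0 < tmin k \<and> tmin k < dfb_taubar P"
  using assms
proof (induction k rule: dec_induct)
  case base
  then show ?case using run adm unfolding DFB_run_def dfb_admissible_def by auto
next
  case (step k)
  have "dfb_theta P ^ i k \<le> 1" "0 < dfb_theta P ^ i k"
    using params by (auto intro: power_le_one)
  then have "0 < \<delta> (Suc k)" "\<delta> (Suc k) \<le> \<delta> k"
    using run_step(3)[OF step(1)] step.IH by (auto intro: mult_left_le_one_le)
  moreover have "dfb_C1 P \<le> C (Suc k)"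
  proof (cases "t k \<ge> tmin k")
    case False
    have "1 * C k \<le> dfb_eta P * C k" using params step.IH by (intro mult_right_mono) auto
    then show ?thesis using False run_step(6)[OF step(1)] step.IH by auto
  qed (use run_step(5)[OF step(1)] step.IH in auto)
  moreover have "0 < tmin (Suc k) \<and> tmin (Suc k) \<le> tmin k"
    using run_step(5,6)[OF step(1)] step.IH params
    by (cases "t k \<ge> tmin k") (auto intro: mult_left_le_one_le)
  ultimately show ?case using step.IH by auto
qed

text \<open>The acceptance test reads \<open>norm (g k) > \<mu> * C k * \<delta> (k + 1)\<close>, while \<open>C k * \<delta> (k + 1)\<close> bounds the
  approximation error; so the relative error is below \<open>1 / \<mu> < 1/2\<close>. Capping the radius by
  \<open>dfb_nu P k\<close> can only make the error bound smaller.\<close>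

lemma gradient_error:
  assumes k: "k \<ge> 1" and x: "x k \<in> ball xbar R"
  shows "norm (g k - gradient f (x k)) \<le> norm (g k) / 2"
proof -
  define d where "d = min (dfb_theta P ^ i k * \<delta> k) (dfb_nu P k)"
  note b = state_bounds[OF k] state_bounds[of "Suc k"]
  have d: "0 < d" "d \<le> \<delta> (Suc k)" "d \<le> dfb_delta1 P"
    unfolding d_def using b run_step(3)[OF k] params(10)[OF k] by auto
  have "norm (g k - gradient f (x k)) \<le> dfb_C1 P * d"
    using approx[OF x d(1,3)] run_step(2)[OF k] by (simp add: d_def)
  also have "\<dots> \<le> C k * \<delta> (Suc k)"
    using b d params by (intro mult_mono) auto
  also have "2 * \<dots> \<le> dfb_mu P * (C k * \<delta> (Suc k))"
    using b params by (intro mult_right_mono) auto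
  moreover have "dfb_mu P * (C k * \<delta> (Suc k)) < norm (g k)"
    using run_step(1)[OF k] run_step(2,3)[OF k] unfolding dfb_accept_def by (simp add: mult_ac)
  ultimately show ?thesis by linarith
qed

lemma gradient_comparison:
  assumes k: "k \<ge> 1" and x: "x k \<in> ball xbar R"
  shows "norm (gradient f (x k)) \<le> 3/2 * norm (g k)" "norm (g k) \<le> 2 * norm (gradient f (x k))"
  using gradient_error[OF assms] norm_triangle_sub[of "g k" "gradient f (x k)"]
    norm_triangle_sub[of "gradient f (x k)" "g k"] by (auto simp: norm_minus_commute)

text \<open>The gradient vanishes at \<open>xbar\<close>, so \<open>norm (g k) \<le> 2 * L * R\<close>, and a trial step is no longer than
  \<open>R / 2\<close>. This keeps it inside the region where the descent estimate is valid.\<close>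

lemma trial_step:
  assumes k: "k \<ge> 1" and x: "x k \<in> ball xbar R" and s: "0 \<le> s" "s \<le> dfb_taubar P"
  shows "x k - s *\<^sub>R g k \<in> ball xbar (2 * R)"
    and "f (x k - s *\<^sub>R g k) \<le> f (x k) - s * (1/2 - L * s) * (norm (g k))\<^sup>2"
proof -
  have "norm (g k) \<le> 2 * (L * R)"
    using gradient_comparison(2)[OF k x] gradient_bound[OF x] by linarith
  then have "s * norm (g k) \<le> 1 / (4 * L) * (2 * (L * R))"
    using s taubar_small L_pos R_pos by (intro mult_mono) auto
  also have "\<dots> \<le> R" using L_pos R_pos by (simp add: field_simps)
  finally show b: "x k - s *\<^sub>R g k \<in> ball xbar (2 * R)"
    using x s dist_triangle[of xbar "x k - s *\<^sub>R g k" "x k"] by (simp add: dist_norm)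
  show "f (x k - s *\<^sub>R g k) \<le> f (x k) - s * (1/2 - L * s) * (norm (g k))\<^sup>2"
    using inexact_gradient_step_decrease[OF gderiv convex_ball in_ballI[OF x] b lipschitz]
      L_pos s gradient_error[OF k x] by auto
qed

text \<open>A failed search has tested, and rejected, every trial step not below the threshold.\<close>

lemma linesearch:
  assumes k: "k \<ge> 1"
  shows "0 \<le> \<tau> k" "\<tau> k \<le> dfb_taubar P"
    and "f (x (Suc k)) \<le> f (x k) - \<beta> * \<tau> k * (norm (g k))\<^sup>2"
    and "\<not> t k \<ge> tmin k \<Longrightarrow> tmin k \<le> \<gamma> ^ m * dfb_taubar P \<Longrightarrow>
      f (x k - (\<gamma> ^ m * dfb_taubar P) *\<^sub>R g k) > f (x k) - \<beta> * (\<gamma> ^ m * dfb_taubar P) * (norm (g k))\<^sup>2"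
proof -
  have \<gamma>: "\<gamma> \<in> {0<..<1}" using params by simp
  obtain j where j: "t k = \<gamma> ^ j * dfb_taubar P"
    "f (x k - t k *\<^sub>R g k) \<le> f (x k) - \<beta> * t k * (norm (g k))\<^sup>2 \<or> t k < tmin k"
    "\<And>m. m < j \<Longrightarrow> f (x k - (\<gamma> ^ m * dfb_taubar P) *\<^sub>R g k)
      > f (x k) - \<beta> * (\<gamma> ^ m * dfb_taubar P) * (norm (g k))\<^sup>2"
    using dfb_backtrack_cases[OF \<gamma>, of "tmin k" f "x k" "g k"] state_bounds[OF k] run_step(4)[OF k]
    by metis
  have tk: "0 < t k" "t k \<le> dfb_taubar P"
    using j(1) params by (auto intro: mult_left_le_one_le power_le_one)
  then show "0 \<le> \<tau> k" "\<tau> k \<le> dfb_taubar P"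
    using run_step(5,6)[OF k] params by (cases "t k \<ge> tmin k"; simp)+
  show "f (x (Suc k)) \<le> f (x k) - \<beta> * \<tau> k * (norm (g k))\<^sup>2"
    using run_step(5,6,7)[OF k] j(2) by (cases "t k \<ge> tmin k") auto
  show "f (x k - (\<gamma> ^ m * dfb_taubar P) *\<^sub>R g k) > f (x k) - \<beta> * (\<gamma> ^ m * dfb_taubar P) * (norm (g k))\<^sup>2"
    if fail: "\<not> t k \<ge> tmin k" and m: "tmin k \<le> \<gamma> ^ m * dfb_taubar P"
  proof (cases "m < j")
    case False
    then have "\<gamma> ^ m * dfb_taubar P \<le> \<gamma> ^ j * dfb_taubar P"
      using params by (intro mult_right_mono power_decreasing) auto
    then show ?thesis using fail m j(1) by simp
  qed (rule j(3))
qed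

lemma value_above_minimum:
  assumes "k \<ge> 1" and "x k \<in> ball xbar (2 * R)"
  shows "r k > 0"
  using noncritical[OF assms(1)] gradient_zero_of_min_value[OF assms(2)] minimal[OF assms(2)]
  by force

text \<open>The factor \<open>1/6\<close> combines the decrease \<open>\<tau> k * norm (g k)\<^sup>2 / 4\<close>, valid since
  \<open>\<tau> k \<le> 1 / (4 * L)\<close>, with \<open>norm (gradient f (x k)) \<le> 3/2 * norm (g k)\<close>.\<close>

lemma actual_step:
  assumes k: "k \<ge> 1" and x: "x k \<in> ball xbar R" and "r k < e"
  shows "r (Suc k) > 0" and "1/6 * \<psi> (r k) * dist (x k) (x (Suc k)) \<le> r k - r (Suc k)"
    and "r (Suc k) \<le> r k"
proof -
  note ls = linesearch(1,2)[OF k]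
  note st = trial_step[OF k x ls, folded run_step(7)[OF k]]
  show "r (Suc k) > 0" using value_above_minimum[of "Suc k"] st(1) by simp
  have "L * \<tau> k \<le> L * (1 / (4 * L))"
    using ls taubar_small L_pos by (intro mult_left_mono) auto
  then have "1/4 \<le> 1/2 - L * \<tau> k" using L_pos by simp
  then have "\<tau> k * (norm (g k))\<^sup>2 * (1/4) \<le> \<tau> k * (norm (g k))\<^sup>2 * (1/2 - L * \<tau> k)"
    using ls by (intro mult_left_mono) auto
  then have dec: "\<tau> k * (norm (g k))\<^sup>2 / 4 \<le> r k - r (Suc k)"
    using st(2) by (simp add: mult_ac)
  moreover have "0 \<le> \<tau> k * (norm (g k))\<^sup>2 / 4" using ls by simp
  ultimately show "r (Suc k) \<le> r k" by linarith
  have "\<psi> (r k) \<le> norm (gradient f (x k))"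
    using KL[OF in_ballI[OF x]] value_above_minimum[OF k in_ballI[OF x]] \<open>r k < e\<close> by simp
  then have "\<psi> (r k) \<le> 3/2 * norm (g k)"
    using gradient_comparison(1)[OF k x] by linarith
  then have "\<psi> (r k) * (\<tau> k * norm (g k)) \<le> 3/2 * norm (g k) * (\<tau> k * norm (g k))"
    using ls by (intro mult_right_mono) auto
  moreover have "dist (x k) (x (Suc k)) = \<tau> k * norm (g k)"
    using run_step(7)[OF k] ls by (simp add: dist_norm)
  ultimately show "1/6 * \<psi> (r k) * dist (x k) (x (Suc k)) \<le> r k - r (Suc k)"
    using dec by (simp add: power2_eq_square mult_ac)
qed

text \<open>As long as the iterates stay in the ball, the path travelled is no longer than
  \<open>6 * \<Phi> (r 1)\<close>. The next iterate lies in the doubled ball, where the value gap is positive, so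
  this bound extends to it and returns it to the small ball.\<close>

lemma trapped:
  assumes "k \<ge> 1"
  shows "x k \<in> ball xbar R" and "r k \<in> {0<..<e}"
proof -
  have "\<forall>k. 1 \<le> k \<and> k \<le> n \<longrightarrow> x k \<in> ball xbar R \<and> r k \<in> {0<..<e}" if "n \<ge> 1" for n
    using that
  proof (induction n rule: dec_induct)
    case base
    have "x k \<in> ball xbar R \<and> r k \<in> {0<..<e}" if "k = 1" for k
      using that start_ball start_value value_above_minimum[of 1] in_ballI by simp
    then show ?case by (metis le_antisym)
  next
    case (step n)
    have n: "1 \<le> n" "x n \<in> ball xbar R" "r n < e" using step by auto
    have r: "r k \<in> {0<..<e}" if "1 \<le> k" "k \<le> Suc n" for k
      using that step.IH actual_step(1,3)[OF n] n by (cases "k = Suc n") auto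
    have "1/6 * dist (x 1) (x (Suc n)) \<le> \<Phi> (r 1)"
      using step.IH r by (intro KL_length_bound[OF desing, of _ _ _ r] \<psi>_pos actual_step(2)) auto
    then have "x (Suc n) \<in> ball xbar R"
      using start_length dist_triangle[of xbar "x (Suc n)" "x 1"] by simp
    then show ?case using step.IH r le_Suc_eq by auto
  qed
  then show "x k \<in> ball xbar R" and "r k \<in> {0<..<e}" using assms by auto
qed

section \<open>Convergence\<close>

text \<open>Trial steps up to \<open>ts = (1/2 - \<beta>) / L\<close> satisfy the sufficient decrease condition, so the
  linesearch succeeds once the threshold \<open>tmin k\<close> is at most \<open>\<gamma> * ts\<close>. Hence the thresholds stay above a
  positive constant. They decrease by the factor \<open>\<gamma>\<close> at every failure, so a positive limit leaves
  room for finitely many failures only; after the last one the stepsize is at least the threshold.\<close>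

lemma stepsize_eventually_bounded_below:
  obtains c N where "c > 0" and "N \<ge> 1" and "\<And>k. k \<ge> N \<Longrightarrow> \<tau> k \<ge> c"
proof -
  define ts where "ts = (1/2 - \<beta>) / L"
  have ts: "ts > 0" using params L_pos by (simp add: ts_def)
  have decrease: "f (x k - s *\<^sub>R g k) \<le> f (x k) - \<beta> * s * (norm (g k))\<^sup>2"
    if "k \<ge> 1" "0 \<le> s" "s \<le> ts" "s \<le> dfb_taubar P" for k s
  proof -
    have "\<beta> \<le> 1/2 - L * s" using that L_pos by (simp add: ts_def field_simps)
    then have "s * (norm (g k))\<^sup>2 * \<beta> \<le> s * (norm (g k))\<^sup>2 * (1/2 - L * s)"
      using that by (intro mult_left_mono) auto
    with trial_step(2)[OF \<open>k \<ge> 1\<close> trapped(1)[OF \<open>k \<ge> 1\<close>] that(2,4)] show ?thesis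
      by (simp add: mult_ac)
  qed
  \<comment> \<open>The first trial step not exceeding \<open>ts\<close> is either \<open>dfb_taubar P\<close> itself or larger than
    \<open>\<gamma> * ts\<close>, so it is reached before the threshold stops the search.\<close>
  have success: "t k \<ge> tmin k" if k: "k \<ge> 1" and small: "tmin k \<le> \<gamma> * ts" for k
  proof (rule ccontr)
    assume fail: "\<not> t k \<ge> tmin k"
    have "(\<lambda>m. \<gamma> ^ m * dfb_taubar P) \<longlonglongrightarrow> 0 * dfb_taubar P"
      using params by (intro tendsto_mult LIMSEQ_power_zero) auto
    then have "\<forall>\<^sub>F m in sequentially. \<gamma> ^ m * dfb_taubar P < ts"
      using ts by (auto dest: order_tendstoD(2))
    then obtain m0 where "\<gamma> ^ m0 * dfb_taubar P \<le> ts"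
      by (auto simp: eventually_sequentially intro: less_imp_le)
    then obtain m where m: "\<gamma> ^ m * dfb_taubar P \<le> ts" "\<And>j. j < m \<Longrightarrow> \<not> \<gamma> ^ j * dfb_taubar P \<le> ts"
      using exists_least_iff[of "\<lambda>m. \<gamma> ^ m * dfb_taubar P \<le> ts"] by blast
    have "tmin k \<le> \<gamma> ^ m * dfb_taubar P"
    proof (cases m)
      case 0
      then show ?thesis using state_bounds[OF k] by simp
    next
      case (Suc j)
      then have "\<gamma> * ts \<le> \<gamma> * (\<gamma> ^ j * dfb_taubar P)"
        using m(2)[of j] params by (intro mult_left_mono) auto
      then show ?thesis using small Suc by simp
    qed
    moreover have "\<gamma> ^ m * dfb_taubar P \<le> dfb_taubar P"
      using params by (auto intro: mult_left_le_one_le power_le_one)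
    ultimately show False
      using linesearch(4)[OF k fail, of m] decrease[OF k _ m(1)] params by force
  qed
  define c where "c = min (tmin 1) (\<gamma> * (\<gamma> * ts))"
  have c: "c > 0" using ts params state_bounds[of 1] by (simp add: c_def)
  have lower: "c \<le> tmin k" if "k \<ge> 1" for k
    using that
  proof (induction k rule: dec_induct)
    case (step k)
    show ?case
    proof (cases "t k \<ge> tmin k")
      case True
      then show ?thesis using run_step(5)[OF step(1)] step.IH by simp
    next
      case False
      then have "\<gamma> * (\<gamma> * ts) \<le> \<gamma> * tmin k"
        using success[OF step(1)] params by (intro mult_left_mono) linarith+
      then show ?thesis using run_step(6)[OF step(1) False] by (simp add: c_def)
    qed
  qed (simp add: c_def)
  have "decseq (\<lambda>k. tmin (Suc k))"
  proof (rule decseq_SucI)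
    fix k
    show "tmin (Suc (Suc k)) \<le> tmin (Suc k)"
      using run_step(5,6)[of "Suc k"] state_bounds[of "Suc k"] params
      by (cases "t (Suc k) \<ge> tmin (Suc k)") (auto intro: mult_left_le_one_le)
  qed
  then obtain l where l: "(\<lambda>k. tmin (Suc k)) \<longlonglongrightarrow> l"
    using decseq_convergent[of "\<lambda>k. tmin (Suc k)" c] lower by (metis le_add1 plus_1_eq_Suc)
  \<comment> \<open>Quotients of consecutive thresholds tend to \<open>1\<close>, whereas a failure gives the quotient \<open>\<gamma>\<close>.\<close>
  have "l \<ge> c" using l lower by (intro LIMSEQ_le_const[OF l]) auto
  then have "(\<lambda>k. tmin (Suc (Suc k)) / tmin (Suc k)) \<longlonglongrightarrow> l / l"
    using l c by (intro tendsto_divide LIMSEQ_Suc[OF l] l) auto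
  then have "\<forall>\<^sub>F k in sequentially. \<gamma> < tmin (Suc (Suc k)) / tmin (Suc k)"
    using params \<open>l \<ge> c\<close> c by (intro order_tendstoD(1)) auto
  then obtain N where N: "\<And>k. k \<ge> N \<Longrightarrow> \<gamma> < tmin (Suc (Suc k)) / tmin (Suc k)"
    by (auto simp: eventually_sequentially)
  have "\<tau> k \<ge> c" if "k \<ge> Suc N" for k
  proof -
    obtain j where j: "k = Suc j" "j \<ge> N" using \<open>k \<ge> Suc N\<close> by (cases k) auto
    have "tmin (Suc k) \<noteq> \<gamma> * tmin k"
      using N[OF j(2)] state_bounds[of k] j(1) by auto
    then have "t k \<ge> tmin k" using run_step(6)[of k] j(1) by auto
    then show ?thesis using run_step(5)[of k] lower[of k] j(1) by simp
  qed
  then show ?thesis using that[of c "Suc N"] c by auto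
qed

lemma values_decrease:
  assumes "k \<ge> 1"
  shows "\<beta> * \<tau> k * (norm (g k))\<^sup>2 \<le> r k - r (Suc k)" "r (Suc k) \<le> r k"
  using linesearch(3)[OF assms] actual_step(3)[OF assms trapped(1)[OF assms]] trapped(2)[OF assms]
  by auto

lemma gradient_le_value_drop:
  assumes k: "k \<ge> 1" and c: "c > 0" and "\<tau> k \<ge> c"
  shows "\<beta> * c * (4/9) * (norm (gradient f (x k)))\<^sup>2 \<le> r k - r (Suc k)"
proof -
  have "(norm (gradient f (x k)))\<^sup>2 \<le> (3/2 * norm (g k))\<^sup>2"
    using gradient_comparison(1)[OF k trapped(1)[OF k]] by (intro power_mono) auto
  then have "(4/9) * (norm (gradient f (x k)))\<^sup>2 \<le> (norm (g k))\<^sup>2"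
    by (simp add: power_mult_distrib power2_eq_square)
  then have "(\<beta> * c) * ((4/9) * (norm (gradient f (x k)))\<^sup>2) \<le> (\<beta> * \<tau> k) * (norm (g k))\<^sup>2"
    using assms params by (intro mult_mono) auto
  then show ?thesis using values_decrease(1)[OF k] by (simp add: mult_ac)
qed

lemma KL_along_iterates:
  assumes "k \<ge> 1"
  shows "\<psi> (r k) \<le> norm (gradient f (x k))"
  using KL[OF in_ballI[OF trapped(1)[OF assms]] trapped(2)[OF assms]] .

text \<open>If the gaps had a positive limit \<open>l\<close>, monotonicity of \<open>\<psi>\<close> and the KL inequality would keep
  the gradients above \<open>\<psi> l > 0\<close>, and every late step would lower the value by a
  fixed amount.\<close>

lemma values_tendsto: "r \<longlonglongrightarrow> 0"
proof -
  obtain c N where cN: "c > 0" "N \<ge> 1" "\<And>k. k \<ge> N \<Longrightarrow> \<tau> k \<ge> c"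
    using stepsize_eventually_bounded_below by blast
  have dec: "decseq (\<lambda>k. r (Suc k))"
    using values_decrease(2) by (intro decseq_SucI) auto
  then obtain l where l': "(\<lambda>k. r (Suc k)) \<longlonglongrightarrow> l"
    using decseq_convergent[of "\<lambda>k. r (Suc k)" 0] trapped(2)
    by (metis (lifting) greaterThanLessThan_iff le_add1 less_imp_le plus_1_eq_Suc)
  then have l: "r \<longlonglongrightarrow> l" by (rule LIMSEQ_imp_Suc[where f = r])
  have l_le: "l \<le> r k" if "k \<ge> 1" for k
    using decseq_ge[OF dec l', of "k - 1"] that by simp
  have l0: "l \<ge> 0" using trapped(2) by (intro LIMSEQ_le_const[OF l'] exI[of _ 0]) (auto simp: less_imp_le)
  have "l \<le> 0"
  proof (rule ccontr)
    assume "\<not> l \<le> 0"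
    then have le: "l \<in> {0<..<e}" using l_le[of 1] trapped(2)[of 1] by auto
    define \<epsilon> where "\<epsilon> = \<beta> * c * (4/9) * (\<psi> l)\<^sup>2"
    have \<epsilon>: "\<epsilon> > 0" unfolding \<epsilon>_def using params cN \<psi>_pos[OF le] by simp
    have "(\<lambda>k. r k - r (Suc k)) \<longlonglongrightarrow> l - l" using l l' by (rule tendsto_diff)
    then have "\<forall>\<^sub>F k in sequentially. r k - r (Suc k) < \<epsilon>"
      using \<epsilon> by (intro order_tendstoD(2)) auto
    then obtain k where k: "k \<ge> N" "r k - r (Suc k) < \<epsilon>"
      unfolding eventually_sequentially by (meson nle_le)
    have k1: "k \<ge> 1" using k cN by simp
    have "\<psi> l \<le> \<psi> (r k)"
      using monotone_onD[OF \<psi>_mono le trapped(2)[OF k1] l_le[OF k1]] .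
    then have "\<psi> l \<le> norm (gradient f (x k))"
      using KL_along_iterates[OF k1] by linarith
    then have "\<epsilon> \<le> \<beta> * c * (4/9) * (norm (gradient f (x k)))\<^sup>2"
      unfolding \<epsilon>_def using \<psi>_pos[OF le] params cN by (intro mult_left_mono power_mono) auto
    then show False using gradient_le_value_drop[OF k1 cN(1) cN(3)[OF k(1)]] k(2) by linarith
  qed
  with l0 l show ?thesis by simp
qed

lemma distance_bound:
  assumes "desingularizing e \<psi> \<Phi>'" and "1 \<le> m" and "m \<le> n"
  shows "dist (x m) (x n) \<le> 6 * \<Phi>' (r m)"
proof -
  have "1/6 * dist (x m) (x n) \<le> \<Phi>' (r m)"
    using assms(2,3) trapped
    by (intro KL_length_bound[OF assms(1), of _ _ _ r] \<psi>_pos actual_step(2)) auto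
  then show ?thesis by simp
qed

text \<open>The length bound applied from index \<open>m\<close> on controls the tail of the path by \<open>6 * \<Phi> (r m)\<close>, which
  tends to \<open>0\<close>. The limit lies in the closed ball of radius \<open>R\<close>, hence in the open doubled ball where
  \<open>f xbar\<close> is the least value; attaining it makes the limit a local minimizer.\<close>

lemma iterates_converge:
  obtains xt where "x \<longlonglongrightarrow> xt" and "f xt = f xbar" and "local_minimizer f xt"
proof -
  have "filterlim r (at_right 0) sequentially"
    using values_tendsto trapped(2) unfolding filterlim_at
    by (auto simp: eventually_sequentially dest!: spec[of _ 1] intro!: exI[of _ 1] less_imp_neq[symmetric])
  then have lim: "(\<lambda>k. 6 * \<Phi> (r k)) \<longlonglongrightarrow> 0"
    using desing unfolding desingularizing_def
    by (intro tendsto_mult_right_zero) (auto intro: filterlim_compose[of \<Phi>])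
  have "Cauchy x"
    unfolding Cauchy_altdef
  proof (intro allI impI)
    fix \<epsilon> :: real assume "\<epsilon> > 0"
    with lim have "\<forall>\<^sub>F k in sequentially. 6 * \<Phi> (r k) < \<epsilon>" by (rule order_tendstoD(2))
    then obtain N where N: "\<And>k. k \<ge> N \<Longrightarrow> 6 * \<Phi> (r k) < \<epsilon>"
      by (auto simp: eventually_sequentially)
    show "\<exists>M. \<forall>m\<ge>M. \<forall>n>m. dist (x m) (x n) < \<epsilon>"
    proof (intro exI[of _ "max N 1"] allI impI)
      fix m n assume "max N 1 \<le> m" "m < n"
      then show "dist (x m) (x n) < \<epsilon>"
        using distance_bound[OF desing, of m n] N[of m] by simp
    qed
  qed
  then obtain xt where xt: "x \<longlonglongrightarrow> xt" by (auto simp: Cauchy_convergent_iff convergent_def)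
  have "(\<lambda>k. f (x k)) \<longlonglongrightarrow> f xt"
    using continuous_f xt by (auto intro: continuous_on_tendsto_compose)
  moreover have "(\<lambda>k. f (x k)) \<longlonglongrightarrow> f xbar"
    using values_tendsto by (simp add: LIM_zero_iff)
  ultimately have eq: "f xt = f xbar" by (rule LIMSEQ_unique)
  have "dist xbar xt \<le> R"
    using trapped(1) by (intro LIMSEQ_le_const2[OF tendsto_dist[OF tendsto_const xt]] exI[of _ 1])
      (auto simp: less_imp_le)
  then have "local_minimizer f xt"
    using local_minimizer_of_min_value[of xt] eq R_pos by simp
  with xt eq show ?thesis by (rule that)
qed

lemma limit_distance_bound:
  assumes "desingularizing e \<psi> \<Phi>'" and "1 \<le> m" and "x \<longlonglongrightarrow> xt"
  shows "norm (x m - xt) \<le> 6 * \<Phi>' (r m)"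
  unfolding dist_norm[symmetric]
  using distance_bound[OF assms(1,2)]
  by (intro LIMSEQ_le_const2[OF tendsto_dist[OF tendsto_const assms(3)]] exI[of _ m]) auto

section \<open>Rates\<close>

text \<open>All three quantities are bounded by powers of the value gap: exponent \<open>1 - q\<close> for the distance,
  \<open>1/2\<close> for the gradient and \<open>1\<close> for the value. In the sublinear case the gap is of order
  \<open>k powr (- 1 / (2 * q - 1))\<close>. Since \<open>1 - q < 1/2\<close> and \<open>2 - 2 * q < 1\<close> there, the
  stated orders for the gradient and the value follow from stronger ones.\<close>

lemma convergence_rates:
  assumes M: "M > 0" and q: "q \<in> {0<..<1}" and \<psi>: "\<And>s. s \<in> {0<..<e} \<Longrightarrow> \<psi> s = M * s powr q"
    and xt: "x \<longlonglongrightarrow> xt"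
  shows "q \<le> 1/2 \<Longrightarrow> converges_linearly x xt \<and>
            converges_linearly (\<lambda>k. gradient f (x k)) 0 \<and>
            converges_linearly (\<lambda>k. f (x k)) (f xbar)"
    and "q > 1/2 \<Longrightarrow>
      (\<lambda>k. norm (x k - xt)) \<in> O(\<lambda>k. real k powr (- ((1 - q) / (2 * q - 1)))) \<and>
      (\<lambda>k. norm (gradient f (x k))) \<in> O(\<lambda>k. real k powr (- ((1 - q) / (2 * q - 1)))) \<and>
      (\<lambda>k. f (x k) - f xbar) \<in> O(\<lambda>k. real k powr (- ((2 - 2 * q) / (2 * q - 1))))"
proof -
  obtain c N0 where cN0: "c > 0" "N0 \<ge> 1" "\<And>k. k \<ge> N0 \<Longrightarrow> \<tau> k \<ge> c"
    using stepsize_eventually_bounded_below by blast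
  have "\<forall>\<^sub>F k in sequentially. r k < 1" using values_tendsto by (intro order_tendstoD(2)) auto
  then obtain N1 where N1: "\<And>k. k \<ge> N1 \<Longrightarrow> r k < 1" by (auto simp: eventually_sequentially)
  define N where "N = max N0 N1"
  define a where "a = \<beta> * c * (4/9)"
  have a: "a > 0" using params cN0 by (simp add: a_def)
  have pos: "r k > 0" if "k \<ge> N" for k
    using trapped(2)[of k] that cN0 by (simp add: N_def)
  have drop: "a * (norm (gradient f (x k)))\<^sup>2 \<le> r k - r (Suc k)" if "k \<ge> N" for k
    unfolding a_def using that cN0 by (intro gradient_le_value_drop) (auto simp: N_def)
  have x_bound: "norm (x k - xt) \<le> 6 / (M * (1 - q)) * r k powr (1 - q)" if "k \<ge> N" for k
    using limit_distance_bound[OF desingularizing_powr[OF M q \<psi>] _ xt, of k] that cN0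
    by (simp add: N_def)
  have grad_bound: "norm (gradient f (x k)) \<le> 1 / sqrt a * r k powr (1/2)" if "k \<ge> N" for k
  proof -
    have "(norm (gradient f (x k)))\<^sup>2 \<le> r k / a"
      using drop[OF that] pos[of "Suc k"] that a by (simp add: field_simps)
    then have "norm (gradient f (x k)) \<le> sqrt (r k / a)" by (rule real_le_rsqrt)
    then show ?thesis using pos[OF that] by (simp add: real_sqrt_divide powr_half_sqrt)
  qed
  have f_bound: "norm (f (x k) - f xbar) \<le> 1 * r k powr 1" if "k \<ge> N" for k
    using pos[OF that] by simp
  have rec: "r (Suc k) \<le> r k - a * M\<^sup>2 * r k powr (2 * q)" if "k \<ge> N" for k
  proof -
    have "M * r k powr q \<le> norm (gradient f (x k))"
      using KL_along_iterates[of k] \<psi>[OF trapped(2)[of k]] that cN0 by (simp add: N_def)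
    then have "(M * r k powr q)\<^sup>2 \<le> (norm (gradient f (x k)))\<^sup>2"
      using M by (intro power_mono) auto
    then have "a * (M * r k powr q)\<^sup>2 \<le> a * (norm (gradient f (x k)))\<^sup>2"
      using a by (intro mult_left_mono) auto
    moreover have "(r k powr q)\<^sup>2 = r k powr (2 * q)"
      by (simp add: power2_eq_square powr_add[symmetric])
    ultimately show ?thesis using drop[OF that] by (simp add: power_mult_distrib mult.assoc)
  qed
  have b: "a * M\<^sup>2 > 0" using a M by simp
  have factors_pos: "6 / (M * (1 - q)) > 0" "1 / sqrt a > 0" "1 - q > 0" using M q a by auto
  show "converges_linearly x xt \<and> converges_linearly (\<lambda>k. gradient f (x k)) 0 \<and>
      converges_linearly (\<lambda>k. f (x k)) (f xbar)" if "q \<le> 1/2"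
  proof -
    \<comment> \<open>The gap is below \<open>1\<close>, so \<open>r k powr (2 * q) \<ge> r k\<close>; capping by \<open>1/2\<close> keeps the
      factor \<open>1 - b\<close> positive.\<close>
    define b where "b = min (a * M\<^sup>2) (1/2)"
    have "r (Suc k) \<le> (1 - b) * r k" if k: "k \<ge> N" for k
    proof -
      have rk: "0 < r k" "r k < 1" using pos N1 k by (auto simp: N_def)
      have "r k powr 1 \<le> r k powr (2 * q)"
        using rk \<open>q \<le> 1/2\<close> by (intro powr_mono') auto
      then have "b * r k \<le> a * M\<^sup>2 * r k powr (2 * q)"
        using rk \<open>a * M\<^sup>2 > 0\<close> unfolding b_def by (intro mult_mono) auto
      then show ?thesis using rec[OF k] by (simp add: algebra_simps)
    qed
    moreover have "b \<in> {0<..<1}" using \<open>a * M\<^sup>2 > 0\<close> by (auto simp: b_def)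
    ultimately obtain c' \<rho> where lin: "c' > 0" "\<rho> \<in> {0<..<1}" "\<And>k. k \<ge> N \<Longrightarrow> r k \<le> c' * \<rho> ^ k"
      using geometric_decay[of b N r] pos by (auto simp: less_imp_le)
    show ?thesis
    proof (intro conjI)
      show "converges_linearly x xt"
        by (rule converges_linearly_of_power_bound[of N _ _ _ r, OF x_bound _ lin(3,1,2)])
          (use pos factors_pos in \<open>auto simp: less_imp_le\<close>)
      show "converges_linearly (\<lambda>k. gradient f (x k)) 0"
        by (rule converges_linearly_of_power_bound[of N _ 0 "1 / sqrt a" r "1/2", OF _ _ lin(3,1,2)])
          (use pos factors_pos grad_bound in \<open>auto simp: less_imp_le\<close>)
      show "converges_linearly (\<lambda>k. f (x k)) (f xbar)"
        by (rule converges_linearly_of_power_bound[of N _ _ _ r, OF f_bound _ lin(3,1,2)])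
          (use pos in \<open>auto simp: less_imp_le\<close>)
    qed
  qed
  show "(\<lambda>k. norm (x k - xt)) \<in> O(\<lambda>k. real k powr (- ((1 - q) / (2 * q - 1)))) \<and>
      (\<lambda>k. norm (gradient f (x k))) \<in> O(\<lambda>k. real k powr (- ((1 - q) / (2 * q - 1)))) \<and>
      (\<lambda>k. f (x k) - f xbar) \<in> O(\<lambda>k. real k powr (- ((2 - 2 * q) / (2 * q - 1))))" if q2: "q > 1/2"
  proof -
    obtain A N' where A: "A > 0" "N' \<ge> N" "\<And>k. k \<ge> N' \<Longrightarrow> r k \<le> A * real k powr (- (1 / (2 * q - 1)))"
      using sublinear_decay[of "a * M\<^sup>2" "2 * q" N r] b q2 pos rec by auto
    have exponent: "(1 - q) / (2 * q - 1) \<le> 1 / (2 * q - 1) * (1/2)" 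
      using divide_right_mono[of "1 - q" "1/2" "2 * q - 1"] q2 by simp
    have pos': "0 \<le> r k" if "k \<ge> N'" for k using pos[of k] that A(2) by simp
    show ?thesis
    proof (intro conjI)
      show "(\<lambda>k. norm (x k - xt)) \<in> O(\<lambda>k. real k powr (- ((1 - q) / (2 * q - 1))))"
        by (rule bigo_of_power_bound[of N' _ "6 / (M * (1 - q))" r "1 - q", OF _ pos' A(3,1)])
          (use A(2) factors_pos x_bound in auto)
      show "(\<lambda>k. norm (gradient f (x k))) \<in> O(\<lambda>k. real k powr (- ((1 - q) / (2 * q - 1))))"
        by (rule bigo_of_power_bound[of N' _ "1 / sqrt a" r "1/2", OF _ pos' A(3,1)])
          (use A(2) factors_pos grad_bound exponent in auto)
      show "(\<lambda>k. f (x k) - f xbar) \<in> O(\<lambda>k. real k powr (- ((2 - 2 * q) / (2 * q - 1))))"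
        by (rule bigo_of_power_bound[of N' _ 1 r 1, OF _ pos' A(3,1)])
          (use A(2) f_bound q2 in \<open>auto intro!: divide_right_mono\<close>)
    qed
  qed
qed

end

section \<open>Local convergence of the derivative-free method\<close>

theorem corollary6p4:
  fixes f :: "real ^ 'n \<Rightarrow> real"
    and G :: "real ^ 'n \<Rightarrow> real \<Rightarrow> real ^ 'n"
    and xbar :: "real ^ 'n"
    and \<Delta> \<eta>' :: real
    and \<psi> :: "real \<Rightarrow> real"
  assumes "C1_smooth f"
    and "locally_lipschitz_gradient f"
    and "\<Delta> > 0"
    and "local_minimizer f xbar"
    and "KL_property_with f xbar \<eta>' \<psi>"
    and "local_approximation f G"
  shows "\<exists>\<xi> T C\<^sub>0. \<xi> > 0 \<and> T > 0 \<and> C\<^sub>0 > 0 \<and>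
    (\<forall>P x g i \<delta> C tmin t \<tau>.
      dfb_admissible P \<and>
      dfb_x1 P \<in> ball xbar \<xi> \<and> dfb_delta1 P \<in> {0<..\<Delta>} \<and>
      dfb_taubar P \<in> {0<..T} \<and> dfb_C1 P \<ge> C\<^sub>0 \<and>
      DFB_run f G P x g i \<delta> C tmin t \<tau> \<and>
      (\<forall>k\<ge>1. gradient f (x k) \<noteq> 0) \<longrightarrow>
      (\<exists>xt. local_minimizer f xt \<and> f xt = f xbar \<and> x \<longlonglongrightarrow> xt \<and>
        (\<forall>M q. bounded_away_from_zero \<tau> \<and> M > 0 \<and> q \<in> {0<..<1} \<and>
            (\<forall>s\<in>{0<..<\<eta>'}. \<psi> s = M * s powr q) \<longrightarrow>
          (q \<in> {0<..1/2} \<longrightarrow>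
            converges_linearly x xt \<and>
            converges_linearly (\<lambda>k. gradient f (x k)) 0 \<and>
            converges_linearly (\<lambda>k. f (x k)) (f xbar)) \<and>
          (q \<in> {1/2<..<1} \<longrightarrow>
            (\<lambda>k. norm (x k - xt)) \<in> O(\<lambda>k. real k powr (- ((1 - q) / (2 * q - 1)))) \<and>
            (\<lambda>k. norm (gradient f (x k))) \<in> O(\<lambda>k. real k powr (- ((1 - q) / (2 * q - 1)))) \<and>
            (\<lambda>k. f (x k) - f xbar) \<in> O(\<lambda>k. real k powr (- ((2 - 2 * q) / (2 * q - 1))))))))"
proof -
  have gd: "GDERIV f y :> gradient f y" for y
    using assms(1) by (auto simp: C1_smooth_def intro: GDERIV_gradient)
  obtain S where S: "open S" "xbar \<in> S" "\<And>y. y \<in> S \<Longrightarrow> f xbar \<le> f y"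
    using assms(4) by (auto simp: local_minimizer_def eventually_nhds)
  obtain U where U: "open U" "xbar \<in> U" "\<And>y. y \<in> U \<Longrightarrow> f xbar < f y \<Longrightarrow> f y < f xbar + \<eta>' \<Longrightarrow>
      \<psi> (f y - f xbar) \<le> norm (gradient f y)"
    using assms(5) unfolding KL_property_with_def by auto
  have "open (S \<inter> U)" "xbar \<in> S \<inter> U" using S U by auto
  then obtain R0 where R0: "R0 > 0" "ball xbar R0 \<subseteq> S \<inter> U" by (meson openE)
  define R where "R = R0 / 2"
  have R: "R > 0" "ball xbar (2 * R) \<subseteq> S" "ball xbar (2 * R) \<subseteq> U" using R0 by (auto simp: R_def)
  obtain L0 where L0: "L0-lipschitz_on (cball xbar (2 * R)) (gradient f)"
    using assms(2) compact_cball unfolding locally_lipschitz_gradient_def by blast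
  define L where "L = max L0 1"
  have "L-lipschitz_on (cball xbar (2 * R)) (gradient f)"
    using L0 by (rule lipschitz_on_le) (simp add: L_def)
  then have lip: "norm (gradient f y - gradient f z) \<le> L * norm (y - z)"
    if "y \<in> ball xbar (2 * R)" "z \<in> ball xbar (2 * R)" for y z
    using that lipschitz_onD[of L "cball xbar (2 * R)" "gradient f" y z] by (simp add: dist_norm)
  have \<eta>': "\<eta>' > 0" using assms(5) unfolding KL_property_with_def by simp
  interpret KL_minimizer f xbar R L \<eta>' \<psi>
  proof
    show "L > 0" by (simp add: L_def)
    show "\<psi> s > 0" if "s \<in> {0<..<\<eta>'}" for s
      using assms(5) that unfolding KL_property_with_def by blast
    show "mono_on {0<..<\<eta>'} \<psi>" using assms(5) unfolding KL_property_with_def by blast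
    show "\<psi> (f y - f xbar) \<le> norm (gradient f y)"
      if "y \<in> ball xbar (2 * R)" "f y - f xbar \<in> {0<..<\<eta>'}" for y
      using that R U(3)[of y] by auto
  qed (use gd R S(3) lip in auto)
  define \<Phi> where "\<Phi> = (\<lambda>s. integral {0..s} (\<lambda>t. 1 / \<psi> t))"
  have \<Phi>: "desingularizing \<eta>' \<psi> \<Phi>"
    unfolding \<Phi>_def by (rule desingularizing_integral[OF assms(5)])
  then have "(\<Phi> \<longlongrightarrow> 0) (at_right 0)" by (simp add: desingularizing_def)
  \<comment> \<open>Half of the ball is reserved for the distance of the start from \<open>xbar\<close>, the other half for
    the path length \<open>6 * \<Phi> (r 1)\<close>; hence the bound \<open>R / 12\<close>.\<close>
  then have "\<forall>\<^sub>F s in at_right 0. \<Phi> s < R / 12" using R by (intro order_tendstoD(2)) auto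
  then obtain \<epsilon> where \<epsilon>: "\<epsilon> > 0" "\<And>s. 0 < s \<Longrightarrow> s < \<epsilon> \<Longrightarrow> \<Phi> s < R / 12"
    by (auto simp: eventually_at_right_field)
  have "(f \<longlongrightarrow> f xbar) (nhds xbar)"
    using continuous_f by (simp add: continuous_on_eq_continuous_at isCont_def tendsto_nhds_iff)
  then have "\<forall>\<^sub>F y in nhds xbar. f y < f xbar + min \<epsilon> \<eta>'"
    using \<epsilon> \<eta>' by (intro order_tendstoD(2)) auto
  then obtain \<xi>0 where \<xi>0: "\<xi>0 > 0" "\<And>y. dist y xbar < \<xi>0 \<Longrightarrow> f y < f xbar + min \<epsilon> \<eta>'"
    by (auto simp: eventually_nhds_metric)
  define \<xi> where "\<xi> = min \<xi>0 (R / 2)"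
  obtain C' where C': "C' > 0" "\<And>y d. y \<in> ball xbar R \<Longrightarrow> d \<in> {0<..\<Delta>} \<Longrightarrow>
      norm (G y d - gradient f y) \<le> C' * d"
    using assms(6) \<open>\<Delta> > 0\<close> bounded_ball[of xbar R] unfolding local_approximation_def by meson
  show ?thesis
  proof (rule exI[of _ \<xi>], rule exI[of _ "1 / (4 * L)"], rule exI[of _ C'], intro conjI allI impI, goal_cases)
    case 1
    then show ?case using \<xi>0 R by (simp add: \<xi>_def)
  next
    case 2
    then show ?case using L_pos by simp
  next
    case 3
    then show ?case using C' by simp
  next
    case (4 P x g i \<delta> C tmin t \<tau>)
    then have adm: "dfb_admissible P" and run: "DFB_run f G P x g i \<delta> C tmin t \<tau>"
      and nc: "\<And>k. k \<ge> 1 \<Longrightarrow> gradient f (x k) \<noteq> 0" by auto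
    have x1: "dist xbar (x 1) < \<xi>" using 4 run unfolding DFB_run_def by simp
    then have x1R: "x 1 \<in> ball xbar R" using R by (simp add: \<xi>_def)
    have v: "f (x 1) - f xbar < min \<epsilon> \<eta>'"
      using \<xi>0(2)[of "x 1"] x1 by (simp add: \<xi>_def dist_commute min_def split: if_splits)
    have "f (x 1) - f xbar > 0"
      using gradient_zero_of_min_value[OF in_ballI[OF x1R]] minimal[OF in_ballI[OF x1R]] nc[of 1]
      by force
    then have "\<Phi> (f (x 1) - f xbar) < R / 12" using \<epsilon>(2) v by simp
    then have start: "dist xbar (x 1) + 6 * \<Phi> (f (x 1) - f xbar) < R"
      using x1 by (simp add: \<xi>_def)
    interpret DFB_near_minimizer f xbar R L \<eta>' \<psi> G P x g i \<delta> C tmin t \<tau> \<Phi>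
    proof
      fix y :: "real ^ 'n" and d :: real assume yd: "y \<in> ball xbar R" "0 < d" "d \<le> dfb_delta1 P"
      then have "norm (G y d - gradient f y) \<le> C' * d" using C'(2)[of y d] 4 by auto
      also have "\<dots> \<le> dfb_C1 P * d" using 4 yd by (intro mult_right_mono) auto
      finally show "norm (G y d - gradient f y) \<le> dfb_C1 P * d" .
    qed (use 4 adm run nc x1R v start \<Phi> in auto)
    obtain xt where xt: "x \<longlonglongrightarrow> xt" "f xt = f xbar" "local_minimizer f xt"
      using iterates_converge by blast
    show ?case
    proof (intro exI[of _ xt] conjI[OF xt(3)] conjI[OF xt(2)] conjI[OF xt(1)] allI impI)
      fix M q
      assume "bounded_away_from_zero \<tau> \<and> M > 0 \<and> q \<in> {0<..<1} \<and>
        (\<forall>s\<in>{0<..<\<eta>'}. \<psi> s = M * s powr q)"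
      then have M: "M > 0" and q: "q \<in> {0<..<1}" and \<psi>: "\<And>s. s \<in> {0<..<\<eta>'} \<Longrightarrow> \<psi> s = M * s powr q"
        by auto
      note rates = convergence_rates[OF M q \<psi> xt(1)]
      show "(q \<in> {0<..1/2} \<longrightarrow>
            converges_linearly x xt \<and>
            converges_linearly (\<lambda>k. gradient f (x k)) 0 \<and>
            converges_linearly (\<lambda>k. f (x k)) (f xbar)) \<and>
          (q \<in> {1/2<..<1} \<longrightarrow>
            (\<lambda>k. norm (x k - xt)) \<in> O(\<lambda>k. real k powr (- ((1 - q) / (2 * q - 1)))) \<and>
            (\<lambda>k. norm (gradient f (x k))) \<in> O(\<lambda>k. real k powr (- ((1 - q) / (2 * q - 1)))) \<and>
            (\<lambda>k. f (x k) - f xbar) \<in> O(\<lambda>k. real k powr (- ((2 - 2 * q) / (2 * q - 1)))))"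
        using rates by auto
    qed
  qed
qed

end
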